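(* Every locally finite tiling of a Banach space $X$ by bounded convex bodies has cardinality $\operatorname{dens}(X)$.
   Context: All spaces are real. $\operatorname{dens}(X)$ is the density character of $X$, the least cardinality of a dense subset of $X$. A convex body is a closed convex set with non-empty interior. A tiling of $X$ is a collection of convex bodies that cover $X$ and have mutually disjoint interiors. A tiling is locally finite if each $x\in X$ has a neighbourhood that intersects only finitely many elements of the tiling. *)

theory Defs
  imports "HOL-Analysis.Analysis"
begin

unbundle cardinal_syntax

text \<open>
  Cardinals are represented, as in the library, by cardinal orders \<open>|A|\<close>, to be compared
  with \<open>\<le>o\<close> and \<open>=o\<close>. The choice below is that of a dense subset of least
  cardinality; its existence is \<open>dens_attained\<close>. For \<open>D \<subseteq> X\<close>, the condition
  \<open>X \<subseteq> closure D\<close> is density of \<open>D\<close> in the subspace \<open>X\<close>.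
\<close>

definition dens :: "'a::topological_space set \<Rightarrow> 'a rel" where
  "dens X = |SOME D. D \<subseteq> X \<and> X \<subseteq> closure D \<and>
                     (\<forall>E. E \<subseteq> X \<and> X \<subseteq> closure E \<longrightarrow> |D| \<le>o |E| )|"

definition convex_body :: "'a::real_normed_vector set \<Rightarrow> bool" where
  "convex_body C \<longleftrightarrow> closed C \<and> convex C \<and> interior C \<noteq> {}"

definition tiling :: "'a::real_normed_vector set set \<Rightarrow> bool" where
  "tiling \<T> \<longleftrightarrow>
     (\<forall>C\<in>\<T>. convex_body C) \<and> \<Union>\<T> = UNIV \<and>
     pairwise (\<lambda>C D. interior C \<inter> interior D = {}) \<T>"

lemma dens_attained:
  fixes X :: "'a::topological_space set"
  obtains D where "D \<subseteq> X" "X \<subseteq> closure D" "dens X = |D|"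
    "\<And>E. \<lbrakk>E \<subseteq> X; X \<subseteq> closure E\<rbrakk> \<Longrightarrow> |D| \<le>o |E|"
proof -
  let ?dense = "\<lambda>D. D \<subseteq> X \<and> X \<subseteq> closure D"
  let ?R = "{|D| |D. ?dense D}"
  have "?dense X"
    by (simp add: closure_subset)
  then have "?R \<noteq> {}" by blast
  moreover have "\<forall>r\<in>?R. Well_order r"
    using card_of_Well_order by blast
  ultimately obtain r where "r \<in> ?R" and min: "\<forall>r'\<in>?R. r \<le>o r'"
    using exists_minim_Well_order[of ?R] by blast
  then obtain D0 where "?dense D0 \<and> (\<forall>E. ?dense E \<longrightarrow> |D0| \<le>o |E| )"
    by blast
  then have "\<exists>D. D \<subseteq> X \<and> X \<subseteq> closure D \<and>
      (\<forall>E. E \<subseteq> X \<and> X \<subseteq> closure E \<longrightarrow> |D| \<le>o |E| )"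
    by blast
  from someI_ex[OF this] show ?thesis
    using that unfolding dens_def by blast
qed

end

theory Submission
  imports Defs
begin

text \<open>
  One inequality is immediate: a dense set has a point in the interior of every tile, and these
  interiors are disjoint. For the other one, let \<open>C\<close> be a tile and let \<open>\<kappa>\<close> be the cardinality of the
  tiling, which is infinite unless \<open>X\<close> is trivial.

  By Hahn--Banach every other tile \<open>D\<close> is separated from \<open>C\<close> by a functional \<open>f\<^sub>D\<close>
  (\<open>separating_functional\<close>). Local finiteness makes \<open>C\<close> polyhedral around each of its boundary
  points \<open>x\<close>: a direction \<open>v\<close> with \<open>f\<^sub>D v < 0\<close> for the finitely many \<open>D\<close> through \<open>x\<close> does not leave
  \<open>C\<close> at once (\<open>tile_stays_in_direction\<close>). In a dual formulation, functionals that attain their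
  supremum on \<open>C\<close> would lie in the span of the \<open>f\<^sub>D\<close>, so by the Bishop--Phelps theorem this span is
  dense in \<open>X\<^sup>*\<close>, and \<open>dens X \<le> dens X\<^sup>* \<le> \<kappa>\<close>. The proof below is a primal version
  of this argument, in which Ekeland's variational principle, the usual source of the
  Bishop--Phelps theorem, is applied to a distance function instead of a functional.

  There is a set \<open>S\<close> of cardinality at most \<open>\<kappa>\<close> that imitates all points of \<open>X\<close> as far
  as the norm and finitely many of the \<open>f\<^sub>D\<close> can tell
  (\<open>small_simultaneous_approximation\<close>). Let \<open>Y\<close> be the span of \<open>S\<close> and an interior point of
  \<open>C\<close>. If \<open>Y\<close> were not dense, Ekeland's principle would give a point \<open>x\<close> of \<open>C\<close> from which the distance
  to \<open>Y\<close> cannot be increased within \<open>C\<close> at a rate of \<open>1/12\<close> or more. But moving \<open>x\<close> away from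
  a nearly closest point of \<open>Y\<close>, corrected by an element of \<open>Y\<close> that cancels the effect on the
  relevant \<open>f\<^sub>D\<close>, stays inside \<open>C\<close> and increases the distance at that rate at least
  (\<open>approximating_subspace_dense\<close>). So \<open>Y\<close> is dense, and rational combinations of its
  generators form a dense set of cardinality at most \<open>\<kappa>\<close>.
\<close>

section \<open>Separation of convex sets in normed spaces\<close>

text \<open>
  The hypotheses say that \<open>M\<close> is the positive cone of an ordering of the space that is total up to
  infinitesimals, and \<open>u\<close> is an order unit. The supremum of all \<open>t\<close> with \<open>t *\<^sub>R u\<close> below \<open>x\<close> is always
  superadditive in \<open>x\<close>; totality makes it odd, hence linear.
\<close>

lemma positive_functional_on_maximal_cone:
  fixes M :: "'a::real_normed_vector set"
  assumes zero: "0 \<notin> M"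
    and add: "\<And>x y. x \<in> M \<Longrightarrow> y \<in> M \<Longrightarrow> x + y \<in> M"
    and scale: "\<And>x t. x \<in> M \<Longrightarrow> 0 < t \<Longrightarrow> t *\<^sub>R x \<in> M"
    and total: "\<And>p w. p \<in> M \<Longrightarrow> w \<notin> M \<Longrightarrow> p - w \<in> M"
    and u: "u \<in> interior M"
  shows "\<exists>f::'a \<Rightarrow> real. bounded_linear f \<and> (\<forall>x\<in>interior M. 0 < f x)"
proof -
  obtain r where r: "r > 0" "ball u r \<subseteq> M"
    using u by (meson mem_interior)
  have uM: "u \<in> M"
    using u interior_subset by blast
  define L where "L x = {t. x - t *\<^sub>R u \<in> M}" for x
  define f where "f x = Sup (L x)" for x
  have large: "t *\<^sub>R u + x \<in> M" if "norm x / r < t" for t x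
  proof -
    have t: "0 < t"
      using that r by (smt (verit) divide_nonneg_pos norm_ge_zero)
    have "norm ((1/t) *\<^sub>R x) < r"
      using that t r by (simp add: field_simps)
    then have "u + (1/t) *\<^sub>R x \<in> M"
      using r(2) by (auto simp: subset_iff dist_norm)
    from scale[OF this t] show ?thesis
      using t by (simp add: scaleR_add_right)
  qed
  have upper: "t \<le> norm x / r" if "t \<in> L x" for t x
  proof (rule ccontr)
    assume "\<not> ?thesis"
    then have "t *\<^sub>R u - x \<in> M"
      using large[of "-x" t] by simp
    with that have "(x - t *\<^sub>R u) + (t *\<^sub>R u - x) \<in> M"
      unfolding L_def using add by blast
    with zero show False by simp
  qed
  have bdd: "bdd_above (L x)" for x
    using upper by (auto simp: bdd_above_def)
  have mem: "- t \<in> L x" if "norm x / r < t" for x t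
    using large[OF that] by (simp add: L_def add.commute)
  have ne: "L x \<noteq> {}" for x
    using mem[of x "norm x / r + 1"] by auto
  have fub: "f x \<le> norm x / r" for x
    unfolding f_def using ne upper by (meson cSup_least)
  have ge: "t \<le> f x" if "t \<in> L x" for t x
    unfolding f_def using bdd that by (rule cSup_upper[rotated])
  have super: "f x + f y \<le> f (x + y)" for x y
  proof -
    have st: "s + t \<le> f (x + y)" if "s \<in> L x" "t \<in> L y" for s t
    proof (rule ge)
      have "(x - s *\<^sub>R u) + (y - t *\<^sub>R u) \<in> M"
        using that add by (auto simp: L_def)
      then show "s + t \<in> L (x + y)"
        by (simp add: L_def algebra_simps)
    qed
    have "f x \<le> f (x + y) - t" if "t \<in> L y" for t
      unfolding f_def[of x] using st[OF _ that] by (intro cSup_least ne) (smt (verit))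
    then have "f y \<le> f (x + y) - f x"
      unfolding f_def[of y] by (intro cSup_least ne) (smt (verit))
    then show ?thesis by simp
  qed
  have neg: "f (- x) = - f x" for x
  proof (rule antisym)
    have "f 0 \<le> 0"
      using fub[of 0] by simp
    then show "f (- x) \<le> - f x"
      using super[of x "- x"] by simp
    show "- f x \<le> f (- x)"
    proof (rule field_le_epsilon)
      fix e :: real assume e: "0 < e"
      let ?t = "f x + e/2"
      have "x - ?t *\<^sub>R u \<notin> M"
        using ge[of ?t x] e by (auto simp: L_def)
      moreover have "(e/2) *\<^sub>R u \<in> M"
        using scale[OF uM] e by simp
      ultimately have "(e/2) *\<^sub>R u - (x - ?t *\<^sub>R u) \<in> M"
        using total by blast
      also have "(e/2) *\<^sub>R u - (x - ?t *\<^sub>R u) = - x - (- (?t + e/2)) *\<^sub>R u"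
        by (simp add: algebra_simps) (simp flip: scaleR_add_left)
      finally have "- (?t + e/2) \<in> L (- x)"
        by (simp add: L_def)
      from ge[OF this] show "- f x \<le> f (- x) + e"
        by simp
    qed
  qed
  have fadd: "f (x + y) = f x + f y" for x y
    using super[of x y] super[of "- x" "- y"] neg[of x] neg[of y] neg[of "x + y"]
    by (simp add: algebra_simps)
  have pos_ge: "c * f x \<le> f (c *\<^sub>R x)" if "0 < c" for c x
  proof -
    have "t \<le> f (c *\<^sub>R x) / c" if "t \<in> L x" for t
    proof -
      have "c *\<^sub>R (x - t *\<^sub>R u) \<in> M"
        using scale that \<open>0 < c\<close> by (auto simp: L_def)
      then have "c * t \<le> f (c *\<^sub>R x)"
        by (intro ge) (simp add: L_def algebra_simps)
      then show ?thesis
        using \<open>0 < c\<close> by (simp add: field_simps)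
    qed
    then have "f x \<le> f (c *\<^sub>R x) / c"
      unfolding f_def[of x] by (intro cSup_least ne)
    then show ?thesis
      using \<open>0 < c\<close> by (simp add: field_simps)
  qed
  have pos: "f (c *\<^sub>R x) = c * f x" if "0 < c" for c x
    using pos_ge[OF that, of x] pos_ge[OF that, of "- x"] by (simp add: neg)
  have hom: "f (c *\<^sub>R x) = c * f x" for c x
  proof (cases c "0::real" rule: linorder_cases)
    case less
    then show ?thesis
      using pos[of "- c" x] neg[of "c *\<^sub>R x"] by simp
  next
    case equal
    then show ?thesis
      using neg[of 0] by simp
  qed (rule pos)
  have "bounded_linear f"
  proof (rule bounded_linear_intro[where K = "1/r"])
    show "norm (f x) \<le> norm x * (1/r)" for x
      using fub[of x] fub[of "- x"] neg[of x] by (simp add: abs_le_iff)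
  qed (simp_all add: fadd hom)
  moreover have "0 < f x" if x: "x \<in> interior M" for x
  proof -
    obtain e where e: "e > 0" "ball x e \<subseteq> M"
      using x by (meson mem_interior)
    define t where "t = e / (norm u + 1)"
    have t: "t > 0" "norm (t *\<^sub>R u) < e"
      using e by (auto simp: t_def field_simps add_pos_nonneg)
    then have "x - t *\<^sub>R u \<in> M"
      using e by (auto simp: subset_iff dist_norm)
    then have "t \<le> f x"
      by (intro ge) (simp add: L_def)
    with t show ?thesis by simp
  qed
  ultimately show ?thesis by blast
qed

text \<open>
  This is the Hahn--Banach theorem in geometric form. Zorn's lemma is applied to convex cones, not to
  partially defined functionals: a cone that contains \<open>A\<close> and is maximal among those that avoid
  \<open>0\<close> is already the positive cone of a linear functional.
\<close>

lemma positive_functional_on_open_convex: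
  fixes A :: "'a::real_normed_vector set"
  assumes A: "open A" "convex A" "A \<noteq> {}" and zero: "0 \<notin> A"
  shows "\<exists>f::'a \<Rightarrow> real. bounded_linear f \<and> (\<forall>x\<in>A. 0 < f x)"
proof -
  define \<P> where "\<P> = {P. A \<subseteq> P \<and> 0 \<notin> P \<and> (\<forall>x\<in>P. \<forall>y\<in>P. x + y \<in> P) \<and>
                         (\<forall>x\<in>P. \<forall>t>0. t *\<^sub>R x \<in> P)}"
  let ?P0 = "{t *\<^sub>R x |t x. 0 < t \<and> x \<in> A}"
  have "?P0 \<in> \<P>"
  proof -
    have "s *\<^sub>R x + t *\<^sub>R y \<in> ?P0" if st: "0 < s" "0 < t" and xy: "x \<in> A" "y \<in> A" for s t x y
    proof -
      let ?z = "(s/(s+t)) *\<^sub>R x + (t/(s+t)) *\<^sub>R y"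
      have "?z \<in> A"
        using A(2) st xy by (intro convexD) (auto simp: add_divide_distrib[symmetric])
      moreover have "s *\<^sub>R x + t *\<^sub>R y = (s + t) *\<^sub>R ?z"
        using st by (simp add: scaleR_add_right)
      moreover have "0 < s + t"
        using st by simp
      ultimately show ?thesis by blast
    qed
    moreover have "A \<subseteq> ?P0"
      using zero_less_one scaleR_one by (smt (verit) mem_Collect_eq subsetI)
    moreover have "r *\<^sub>R (t *\<^sub>R x) \<in> ?P0" if "0 < r" "0 < t" "x \<in> A" for r t x
      using that by (metis (mono_tags, lifting) mem_Collect_eq mult_pos_pos scaleR_scaleR)
    ultimately show ?thesis
      using zero unfolding \<P>_def by fastforce
  qed
  moreover have "\<Union>\<C> \<in> \<P>" if "\<C> \<noteq> {}" and ch: "subset.chain \<P> \<C>" for \<C>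
  proof -
    have sub: "\<C> \<subseteq> \<P>" and lin: "\<And>P Q. P \<in> \<C> \<Longrightarrow> Q \<in> \<C> \<Longrightarrow> P \<subseteq> Q \<or> Q \<subseteq> P"
      using ch by (auto simp: subset_chain_def)
    have add: "x + y \<in> \<Union>\<C>" if xy: "x \<in> P" "P \<in> \<C>" "y \<in> Q" "Q \<in> \<C>" for x y P Q
    proof -
      obtain R where "R \<in> \<C>" "x \<in> R" "y \<in> R"
        using lin[OF xy(2,4)] xy by blast
      then show ?thesis
        using sub unfolding \<P>_def by blast
    qed
    have inP: "A \<subseteq> P" "0 \<notin> P" "\<And>x t. x \<in> P \<Longrightarrow> 0 < t \<Longrightarrow> t *\<^sub>R x \<in> P" if "P \<in> \<C>" for P
      using subsetD[OF sub that] by (auto simp: \<P>_def)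
    show ?thesis
      unfolding \<P>_def
    proof (intro CollectI conjI ballI allI impI)
      show "A \<subseteq> \<Union>\<C>"
        using \<open>\<C> \<noteq> {}\<close> inP(1) by blast
      show "0 \<notin> \<Union>\<C>"
        using inP(2) by blast
      show "x + y \<in> \<Union>\<C>" if "x \<in> \<Union>\<C>" "y \<in> \<Union>\<C>" for x y
        using that add by (elim UnionE)
      show "t *\<^sub>R x \<in> \<Union>\<C>" if "x \<in> \<Union>\<C>" "0 < t" for x and t :: real
        using that inP(3) by blast
    qed
  qed
  ultimately obtain M where M: "M \<in> \<P>" and max: "\<And>N. N \<in> \<P> \<Longrightarrow> M \<subseteq> N \<Longrightarrow> N = M"
    using subset_Zorn_nonempty[of \<P>] by blast
  have AM: "A \<subseteq> M" and M0: "0 \<notin> M" and Madd: "\<And>x y. x \<in> M \<Longrightarrow> y \<in> M \<Longrightarrow> x + y \<in> M"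
    and Mscale: "\<And>x t. x \<in> M \<Longrightarrow> 0 < t \<Longrightarrow> t *\<^sub>R x \<in> M"
    using M by (auto simp: \<P>_def)
  have total: "p - w \<in> M" if p: "p \<in> M" and w: "w \<notin> M" for p w
  proof -
    \<comment> \<open>If \<open>w\<close> is not in \<open>M\<close>, then adjoining the direction \<open>- w\<close> to \<open>M\<close> cannot produce \<open>0\<close>, so by
      maximality it adds nothing.\<close>
    let ?N = "{q - t *\<^sub>R w |q t. q \<in> M \<and> 0 \<le> t}"
    have mem: "q - t *\<^sub>R w \<in> ?N" if "q \<in> M" "0 \<le> t" for q t
      using that by blast
    have MN: "M \<subseteq> ?N"
      using mem[of _ 0] by auto
    have "0 \<notin> ?N"
    proof
      assume "0 \<in> ?N"
      then obtain q t where qt: "q \<in> M" "0 \<le> t" "q = t *\<^sub>R w"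
        by auto
      then have "0 < t"
        using M0 by (cases "t = 0") auto
      with qt Mscale[of q "1/t"] w show False by simp
    qed
    moreover have "(q - s *\<^sub>R w) + (q' - t *\<^sub>R w) \<in> ?N"
      if "q \<in> M" "0 \<le> s" "q' \<in> M" "0 \<le> t" for q s q' t
      using mem[OF Madd[OF that(1,3)], of "s + t"] that by (simp add: algebra_simps)
    moreover have "r *\<^sub>R (q - t *\<^sub>R w) \<in> ?N" if "q \<in> M" "0 \<le> t" "0 < r" for q t r
      using mem[OF Mscale[OF that(1,3)], of "r * t"] that by (simp add: algebra_simps)
    ultimately have "?N \<in> \<P>"
      using AM MN unfolding \<P>_def by blast
    from max[OF this MN] mem[OF p, of 1] show ?thesis by simp
  qed
  have AiM: "A \<subseteq> interior M"
    using AM A(1) by (simp add: interior_maximal)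
  with A(3) obtain u where "u \<in> interior M" by blast
  from positive_functional_on_maximal_cone[OF M0 Madd Mscale total this] AiM
  show ?thesis by blast
qed

lemma convex_subset_closure_interior:
  fixes C :: "'a::real_normed_vector set"
  assumes C: "convex C" "interior C \<noteq> {}"
  shows "C \<subseteq> closure (interior C)"
proof
  fix x assume x: "x \<in> C"
  obtain a where a: "a \<in> interior C"
    using C by blast
  define y where "y e = (1 - e) *\<^sub>R x + e *\<^sub>R a" for e :: real
  have y: "y e \<in> interior C" if e: "0 < e" "e \<le> 1" for e
  proof -
    have "open ((+) ((1 - e) *\<^sub>R x) ` (\<lambda>b. e *\<^sub>R b) ` interior C)"
      using e by (intro open_translation open_scaling) auto
    moreover have "(+) ((1 - e) *\<^sub>R x) ` (\<lambda>b. e *\<^sub>R b) ` interior C \<subseteq> C"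
      using e x C(1) interior_subset[of C] by (auto intro!: convexD)
    ultimately have "(+) ((1 - e) *\<^sub>R x) ` (\<lambda>b. e *\<^sub>R b) ` interior C \<subseteq> interior C"
      by (simp add: interior_maximal)
    then show ?thesis
      using a unfolding y_def by blast
  qed
  have "(y \<longlongrightarrow> (1 - 0) *\<^sub>R x + 0 *\<^sub>R a) (at_right 0)"
    unfolding y_def by (intro tendsto_intros)
  moreover have "eventually (\<lambda>e. y e \<in> closure (interior C)) (at_right 0)"
    using y closure_subset[of "interior C"]
    by (fastforce simp: eventually_at_right_field intro!: exI[of _ 1])
  ultimately show "x \<in> closure (interior C)"
    using Lim_in_closed_set[OF closed_closure, of y _ "at_right 0"] by auto
qed

lemma separating_functional:
  fixes C D :: "'a::real_normed_vector set"
  assumes C: "convex C" "interior C \<noteq> {}" and D: "convex D" "interior D \<noteq> {}"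
    and disj: "interior C \<inter> interior D = {}"
  shows "\<exists>f::'a \<Rightarrow> real. bounded_linear f \<and> (\<forall>c\<in>C. \<forall>d\<in>D. f c \<le> f d) \<and>
                     (\<forall>c\<in>interior C. \<forall>d\<in>D. f c < f d)"
proof -
  \<comment> \<open>This form of disjointness gives the strict inequality up to the boundary of \<open>D\<close>.\<close>
  have disj': "interior C \<inter> D = {}"
    using open_Int_closure_eq_empty[of "interior C" "interior D"] disj
      convex_subset_closure_interior[OF D] by blast
  define A where "A = (\<Union>d\<in>D. \<Union>c\<in>interior C. {d - c})"
  have "open (\<Union>d\<in>D. \<Union>c\<in>uminus ` interior C. {d + c})"
    by (intro open_sums disjI2 open_negations) simp
  then have "open A"
    by (simp add: A_def)
  moreover have "convex A"
    unfolding A_def using C D by (intro convex_differences convex_interior)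
  moreover have "A \<noteq> {}"
    using C D interior_subset[of D] by (auto simp: A_def)
  moreover have "0 \<notin> A"
    using disj' by (auto simp: A_def)
  ultimately obtain f :: "'a \<Rightarrow> real" where f: "bounded_linear f" and pos: "\<And>x. x \<in> A \<Longrightarrow> 0 < f x"
    using positive_functional_on_open_convex by metis
  have strict: "f c < f d" if "c \<in> interior C" "d \<in> D" for c d
  proof -
    have "0 < f (d - c)"
      using that by (intro pos) (auto simp: A_def)
    then show ?thesis
      using f by (simp add: bounded_linear.linear linear_diff)
  qed
  have "f c \<le> f d" if c: "c \<in> C" and d: "d \<in> D" for c d
  proof -
    have "closed {x. f x \<le> f d}"
      using f by (intro closed_Collect_le continuous_intros)
        (simp_all add: linear_continuous_on)
    moreover have "interior C \<subseteq> {x. f x \<le> f d}"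
      using strict d by fastforce
    ultimately have "closure (interior C) \<subseteq> {x. f x \<le> f d}"
      by (rule closure_minimal[rotated])
    then show ?thesis
      using c convex_subset_closure_interior[OF C] by blast
  qed
  with f strict show ?thesis by blast
qed


section \<open>Ekeland's variational principle\<close>

text \<open>
  The relation \<open>\<phi> x + \<epsilon> * dist x y \<le> \<phi> y\<close> is a partial order. A chain in which each
  step gains at least half of what can still be gained is Cauchy, since distances are
  controlled by increments of \<open>\<phi>\<close>, and its limit is a maximal element.
\<close>

lemma ekeland_maximum:
  fixes C :: "'a::complete_space set" and \<phi> :: "'a \<Rightarrow> real"
  assumes C: "closed C" "a \<in> C" and cont: "continuous_on C \<phi>"
    and bdd: "bdd_above (\<phi> ` C)" and \<epsilon>: "0 < \<epsilon>"
  obtains x where "x \<in> C" "\<phi> a \<le> \<phi> x"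
    "\<And>y. y \<in> C \<Longrightarrow> \<phi> x + \<epsilon> * dist x y \<le> \<phi> y \<Longrightarrow> y = x"
proof -
  define S where "S x = {y \<in> C. \<phi> x + \<epsilon> * dist x y \<le> \<phi> y}" for x
  have refl: "x \<in> S x" if "x \<in> C" for x
    using that by (simp add: S_def)
  have trans: "z \<in> S x" if "y \<in> S x" "z \<in> S y" for x y z
  proof -
    have "\<epsilon> * dist x z \<le> \<epsilon> * dist x y + \<epsilon> * dist y z"
      using \<epsilon> by (simp add: dist_triangle flip: distrib_left)
    with that show ?thesis by (auto simp: S_def)
  qed
  have bddS: "bdd_above (\<phi> ` S x)" for x
    using bdd by (rule bdd_above_mono) (auto simp: S_def)
  have step: "\<exists>y\<in>S x. Sup (\<phi> ` S x) \<le> 2 * \<phi> y - \<phi> x" if x: "x \<in> C" for x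
  proof (cases "\<phi> x < Sup (\<phi> ` S x)")
    case True
    then have "(\<phi> x + Sup (\<phi> ` S x)) / 2 < Sup (\<phi> ` S x)" by simp
    moreover have "\<phi> ` S x \<noteq> {}"
      using refl[OF x] by blast
    ultimately have "\<exists>v\<in>\<phi> ` S x. (\<phi> x + Sup (\<phi> ` S x)) / 2 < v"
      by (intro less_cSupD)
    then show ?thesis by force
  next
    case False
    then show ?thesis
      using refl[OF x] by (intro bexI[of _ x]) auto
  qed
  obtain X where X0: "X 0 = a" and XC: "\<And>n. X n \<in> C"
    and XS: "\<And>n. X (Suc n) \<in> S (X n) \<and> Sup (\<phi> ` S (X n)) \<le> 2 * \<phi> (X (Suc n)) - \<phi> (X n)"
  proof -
    have "\<exists>X. \<forall>n. (X n \<in> C \<and> (n = 0 \<longrightarrow> X n = a)) \<and>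
        (X (Suc n) \<in> S (X n) \<and> Sup (\<phi> ` S (X n)) \<le> 2 * \<phi> (X (Suc n)) - \<phi> (X n))"
    proof (rule dependent_nat_choice)
      show "\<exists>x. x \<in> C \<and> (0 = (0::nat) \<longrightarrow> x = a)"
        using C(2) by blast
    next
      fix x and n :: nat
      assume "x \<in> C \<and> (n = 0 \<longrightarrow> x = a)"
      with step[of x]
      show "\<exists>y. (y \<in> C \<and> (Suc n = 0 \<longrightarrow> y = a)) \<and>
                y \<in> S x \<and> Sup (\<phi> ` S x) \<le> 2 * \<phi> y - \<phi> x"
        by (auto simp: S_def)
    qed
    then show ?thesis
      using that by blast
  qed
  have chain: "X n \<in> S (X m)" if "m \<le> n" for m n
    using that
  proof (induction n rule: dec_induct)
    case base
    show ?case by (rule refl[OF XC])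
  next
    case (step n)
    then show ?case using trans XS by blast
  qed
  have "incseq (\<lambda>n. \<phi> (X n))"
    using XS \<epsilon> by (intro incseq_SucI) (smt (verit) S_def mem_Collect_eq mult_nonneg_nonneg zero_le_dist)
  moreover have "bdd_above (range (\<lambda>n. \<phi> (X n)))"
    using bdd by (rule bdd_above_mono) (use XC in auto)
  ultimately have lim: "(\<lambda>n. \<phi> (X n)) \<longlonglongrightarrow> (SUP n. \<phi> (X n))"
    by (rule LIMSEQ_incseq_SUP[rotated])
  then have cau: "Cauchy (\<lambda>n. \<phi> (X n))"
    by (rule LIMSEQ_imp_Cauchy)
  have "Cauchy X"
  proof (rule metric_CauchyI)
    fix e :: real assume e: "0 < e"
    obtain N where N: "\<And>m n. m \<ge> N \<Longrightarrow> n \<ge> N \<Longrightarrow> dist (\<phi> (X m)) (\<phi> (X n)) < \<epsilon> * e"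
      using metric_CauchyD[OF cau, of "\<epsilon> * e"] e \<epsilon> by auto
    have le: "dist (X m) (X n) < e" if "N \<le> m" "m \<le> n" for m n
    proof -
      have "\<epsilon> * dist (X m) (X n) \<le> \<phi> (X n) - \<phi> (X m)"
        using chain[OF that(2)] by (simp add: S_def)
      also have "\<dots> < \<epsilon> * e"
        using N[of m n] that by (simp add: dist_real_def)
      finally show ?thesis using \<epsilon> by simp
    qed
    show "\<exists>N. \<forall>m\<ge>N. \<forall>n\<ge>N. dist (X m) (X n) < e"
      using le by (metis dist_commute nle_le)
  qed
  then obtain x where x: "X \<longlonglongrightarrow> x"
    using Cauchy_convergent convergent_def by blast
  have xC: "x \<in> C"
    using C(1) XC x by (rule closed_sequentially)
  have \<phi>x: "(\<lambda>n. \<phi> (X n)) \<longlonglongrightarrow> \<phi> x"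
    by (rule continuous_on_tendsto_compose[OF cont x xC]) (simp add: XC)
  have xS: "x \<in> S (X n)" for n
  proof -
    have "\<phi> (X n) + \<epsilon> * dist (X n) x \<le> \<phi> x"
    proof (rule tendsto_le[OF _ \<phi>x])
      show "(\<lambda>k. \<phi> (X n) + \<epsilon> * dist (X n) (X k)) \<longlonglongrightarrow> \<phi> (X n) + \<epsilon> * dist (X n) x"
        by (intro tendsto_intros x)
      show "\<forall>\<^sub>F k in sequentially. \<phi> (X n) + \<epsilon> * dist (X n) (X k) \<le> \<phi> (X k)"
        using chain[of n] by (auto simp: S_def eventually_sequentially)
    qed simp
    with xC show ?thesis by (simp add: S_def)
  qed
  show ?thesis
  proof (rule that[OF xC])
    have "0 \<le> \<epsilon> * dist a x"
      using \<epsilon> by simp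
    then show "\<phi> a \<le> \<phi> x"
      using xS[of 0] by (simp add: S_def X0)
  next
    fix y assume "y \<in> C" and y: "\<phi> x + \<epsilon> * dist x y \<le> \<phi> y"
    then have "y \<in> S (X n)" for n
      using trans[OF xS] by (simp add: S_def)
    then have "\<phi> y \<le> 2 * \<phi> (X (Suc n)) - \<phi> (X n)" for n
      using XS[of n] bddS by (meson cSUP_upper order_trans)
    moreover have "(\<lambda>n. 2 * \<phi> (X (Suc n)) - \<phi> (X n)) \<longlonglongrightarrow> 2 * \<phi> x - \<phi> x"
      by (intro tendsto_intros \<phi>x LIMSEQ_Suc)
    ultimately have "\<phi> y \<le> 2 * \<phi> x - \<phi> x"
      by (intro LIMSEQ_le_const) auto
    with y have "\<epsilon> * dist x y \<le> 0" by simp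
    then show "y = x"
      using \<epsilon> by (simp add: mult_le_0_iff)
  qed
qed

section \<open>Small approximating sets\<close>

lemma card_of_Times_ordLeq_infinite:
  assumes "infinite B" "|A| \<le>o |B|" "|A'| \<le>o |B|"
  shows "|A \<times> A'| \<le>o |B|"
  using assms by (intro card_of_Times_ordLeq_infinite_Field)
    (auto simp: Field_card_of card_of_card_order_on)

lemma card_of_insert_ordLeq_infinite:
  assumes "infinite B" "|A| \<le>o |B|"
  shows "|insert x A| \<le>o |B|"
proof -
  have "B \<noteq> {}"
    using assms(1) by auto
  then have "|{x}| \<le>o |B|"
    by (rule card_of_singl_ordLeq)
  with assms have "|{x} \<union> A| \<le>o |B|"
    by (intro card_of_Un_ordLeq_infinite_Field) (auto simp: Field_card_of card_of_card_order_on)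
  then show ?thesis by simp
qed

lemma card_of_lists_ordLeq_infinite:
  assumes inf: "infinite B" and A: "|A| \<le>o |B|"
  shows "|lists A| \<le>o |B|"
proof -
  have len: "|{xs \<in> lists A. length xs = n}| \<le>o |B|" for n
  proof (induction n)
    case 0
    have "{xs \<in> lists A. length xs = 0} = {[]}" by auto
    then show ?case
      using inf card_of_singl_ordLeq[of B] by fastforce
  next
    case (Suc n)
    have "{xs \<in> lists A. length xs = Suc n} =
        (\<lambda>(x, xs). x # xs) ` (A \<times> {xs \<in> lists A. length xs = n})"
      by (auto simp: length_Suc_conv image_iff)
    moreover have "|A \<times> {xs \<in> lists A. length xs = n}| \<le>o |B|"
      by (rule card_of_Times_ordLeq_infinite[OF inf A Suc])
    ultimately show ?case
      using ordLeq_transitive[OF card_of_image] by (simp only:)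
  qed
  have "lists A = (\<Union>n. {xs \<in> lists A. length xs = n})" by auto
  moreover have "|\<Union>n::nat. {xs \<in> lists A. length xs = n}| \<le>o |B|"
    using inf len infinite_iff_card_of_nat by (intro card_of_UNION_ordLeq_infinite) auto
  ultimately show ?thesis by metis
qed

lemma card_of_countable_ordLeq_infinite:
  assumes "infinite B" and "countable A"
  shows "|A| \<le>o |B|"
proof -
  have "|A| \<le>o |UNIV::nat set|"
    using assms(2) by (auto simp: countable_def simp flip: card_of_ordLeq)
  then show ?thesis
    using assms(1) infinite_iff_card_of_nat ordLeq_transitive by blast
qed

text \<open>
  For finitely many functions and a mesh \<open>1 / n\<close>, it is enough to choose one point in each
  nonempty cell of the resulting grid; there are countably many cells for each finite list of
  functions, and only \<open>|B|\<close> such lists.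
\<close>

lemma small_simultaneous_approximation:
  fixes G :: "('a \<Rightarrow> real) set" and B :: "'b set"
  assumes inf: "infinite B" and G: "|G| \<le>o |B|"
  obtains S :: "'a set" where "|S| \<le>o |B|"
    "\<And>F x \<eta>. finite F \<Longrightarrow> F \<subseteq> G \<Longrightarrow> 0 < \<eta> \<Longrightarrow> \<exists>s\<in>S. \<forall>g\<in>F. \<bar>g s - g x\<bar> < \<eta>"
proof -
  define cell where "cell n gs x = map (\<lambda>g. \<lfloor>real n * g x\<rfloor>) gs"
    for n :: nat and gs :: "('a \<Rightarrow> real) list" and x
  define rep where "rep = (\<lambda>((n, js), gs). SOME x. cell n gs x = js)"
  let ?I = "(UNIV :: (nat \<times> int list) set) \<times> lists G"
  have "|?I| \<le>o |B|"
    using card_of_lists_ordLeq_infinite[OF inf G]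
    by (rule card_of_Times_ordLeq_infinite[OF inf card_of_countable_ordLeq_infinite[OF inf], rotated])
      simp
  then have "|rep ` ?I| \<le>o |B|"
    using ordLeq_transitive[OF card_of_image] by blast
  moreover have "\<exists>s\<in>rep ` ?I. \<forall>g\<in>F. \<bar>g s - g x\<bar> < \<eta>"
    if F: "finite F" "F \<subseteq> G" and \<eta>: "0 < \<eta>" for F x \<eta>
  proof -
    obtain gs where gs: "set gs = F"
      using F(1) finite_list by blast
    obtain n where n: "n \<noteq> 0" "1 / real n < \<eta>"
      using reals_Archimedean[OF \<eta>] by (metis inverse_eq_divide nat.simps(3))
    define s where "s = rep ((n, cell n gs x), gs)"
    have "cell n gs s = cell n gs x"
      unfolding s_def rep_def by (auto intro: someI)
    then have "\<bar>real n * g s - real n * g x\<bar> < 1" if "g \<in> F" for g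
    proof -
      have "\<lfloor>real n * g s\<rfloor> = \<lfloor>real n * g x\<rfloor>"
        using \<open>cell n gs s = cell n gs x\<close> that gs by (auto simp: cell_def)
      then show ?thesis by linarith
    qed
    then have "real n * \<bar>g s - g x\<bar> < 1" if "g \<in> F" for g
      using that by (simp add: abs_mult flip: right_diff_distrib)
    then have "\<bar>g s - g x\<bar> < \<eta>" if "g \<in> F" for g
      using that n by (smt (verit) mult.commute of_nat_0_less_iff gr0I pos_less_divide_eq)
    moreover have "s \<in> rep ` ?I"
      unfolding s_def using gs F by auto
    ultimately show ?thesis by blast
  qed
  ultimately show ?thesis
    by (rule that)
qed

lemma small_dense_subset_of_span:
  fixes S :: "'a::real_normed_vector set" and B :: "'b set"
  assumes inf: "infinite B" and S: "|S| \<le>o |B|"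
  obtains Q where "|Q| \<le>o |B|" "span S \<subseteq> closure Q"
proof -
  define comb :: "(rat \<times> 'a) list \<Rightarrow> 'a"
    where "comb l = sum_list (map (\<lambda>(q, a). of_rat q *\<^sub>R a) l)" for l
  let ?Q = "comb ` lists (UNIV \<times> S)"
  have "|(UNIV :: rat set) \<times> S| \<le>o |B|"
    using S
    by (rule card_of_Times_ordLeq_infinite[OF inf card_of_countable_ordLeq_infinite[OF inf], rotated])
      simp
  from card_of_lists_ordLeq_infinite[OF inf this] have "|?Q| \<le>o |B|"
    using ordLeq_transitive[OF card_of_image] by blast
  moreover have "x \<in> closure ?Q" if "x \<in> span S" for x
    using that
  proof (induction rule: span_induct_alt)
    case base
    have "comb [] \<in> ?Q" by (intro imageI) simp
    then have "0 \<in> ?Q" by (simp add: comb_def)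
    then show ?case
      using closure_subset by (rule rev_subsetD)
  next
    case (step c a x)
    have "c \<in> closure \<rat>"
      by (simp add: Rats_closure_real)
    then have "c *\<^sub>R a \<in> closure ((\<lambda>q. q *\<^sub>R a) ` \<rat>)"
      using closure_bounded_linear_image_subset[OF bounded_linear_scaleR_left] by blast
    with step have "c *\<^sub>R a + x \<in> closure ((\<lambda>q. q *\<^sub>R a) ` \<rat> + ?Q)"
      using closure_sum by blast
    moreover have "(\<lambda>q. q *\<^sub>R a) ` \<rat> + ?Q \<subseteq> ?Q"
    proof
      fix z assume "z \<in> (\<lambda>q. q *\<^sub>R a) ` \<rat> + ?Q"
      then obtain q l where "z = of_rat q *\<^sub>R a + comb l" "l \<in> lists (UNIV \<times> S)"
        by (auto simp: set_plus_def Rats_def)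
      then have "z = comb ((q, a) # l)" "(q, a) # l \<in> lists (UNIV \<times> S)"
        using step by (auto simp: comb_def)
      then show "z \<in> ?Q" by blast
    qed
    ultimately show ?case
      using closure_mono by blast
  qed
  ultimately show ?thesis
    using that by blast
qed

section \<open>A subspace that a locally finite tiling forces to be dense\<close>

lemma locally_finite_cover_neighbourhood:
  fixes \<T> :: "'a::topological_space set set"
  assumes lf: "locally_finite_in euclidean \<T>" and cover: "\<Union>\<T> = UNIV"
    and closed: "\<And>D. D \<in> \<T> \<Longrightarrow> closed D"
  obtains W where "open W" "x \<in> W" "finite {D \<in> \<T>. x \<in> D}" "W \<subseteq> \<Union>{D \<in> \<T>. x \<in> D}"
proof -
  obtain V where V: "open V" "x \<in> V" "finite {D \<in> \<T>. D \<inter> V \<noteq> {}}"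
    using lf by (auto simp: locally_finite_in_def)
  let ?F = "{D \<in> \<T>. D \<inter> V \<noteq> {}}"
  let ?W = "V - \<Union>{D \<in> ?F. x \<notin> D}"
  show ?thesis
  proof (rule that)
    show "open ?W"
      using V closed by (intro open_Diff closed_Union) (auto intro: finite_subset[OF _ V(3)])
    show "finite {D \<in> \<T>. x \<in> D}"
      using V(2) by (intro finite_subset[OF _ V(3)]) blast
    show "?W \<subseteq> \<Union>{D \<in> \<T>. x \<in> D}"
    proof
      fix w assume w: "w \<in> ?W"
      obtain D where "D \<in> \<T>" "w \<in> D"
        using cover by (metis UNIV_I UnionE)
      with w show "w \<in> \<Union>{D \<in> \<T>. x \<in> D}" by auto
    qed
  qed (use V in auto)
qed

text \<open>
  The distance to \<open>Y\<close> is the quotient norm modulo \<open>Y\<close>, hence it is homogeneous and invariant under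
  translation by \<open>Y\<close>. This bound measures how fast it grows along a ray.
\<close>

lemma infdist_subspace_scale_ge:
  fixes Y :: "'a::real_normed_vector set"
  assumes Y: "subspace Y" "y \<in> Y" and c: "0 < c"
  shows "c * infdist x Y \<le> infdist (c *\<^sub>R x - y) Y"
proof -
  have "c * infdist x Y \<le> dist (c *\<^sub>R x - y) z" if z: "z \<in> Y" for z
  proof -
    have "infdist x Y \<le> dist x ((1/c) *\<^sub>R (y + z))"
      using Y z by (intro infdist_le subspace_scale subspace_add)
    then have "c * infdist x Y \<le> c * norm (x - (1/c) *\<^sub>R (y + z))"
      using c by (simp add: dist_norm)
    also have "\<dots> = norm (c *\<^sub>R (x - (1/c) *\<^sub>R (y + z)))"
      using c by simp
    also have "c *\<^sub>R (x - (1/c) *\<^sub>R (y + z)) = c *\<^sub>R x - y - z"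
      using c by (simp add: algebra_simps)
    finally show ?thesis by (simp add: dist_norm)
  qed
  moreover have "Y \<noteq> {}"
    using Y by blast
  ultimately show ?thesis
    unfolding infdist_notempty[OF \<open>Y \<noteq> {}\<close>, of "c *\<^sub>R x - y"] by (intro cINF_greatest)
qed

lemma interior_point_off_subspace:
  fixes Y :: "'a::real_normed_vector set"
  assumes Y: "subspace Y" "a \<in> Y" "a \<in> interior C" and z: "z \<notin> closure Y"
  obtains b where "b \<in> C" "0 < infdist b Y"
proof -
  obtain r where r: "0 < r" "ball a r \<subseteq> C"
    using Y by (meson mem_interior)
  define t where "t = r / (norm z + 1)"
  have t: "0 < t" "norm (t *\<^sub>R z) < r"
    using r by (auto simp: t_def field_simps add_pos_nonneg)
  have "infdist z Y \<noteq> 0"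
    using z Y in_closure_iff_infdist_zero by blast
  then have "0 < t * infdist z Y"
    using infdist_nonneg[of z Y] t by simp
  also have "\<dots> \<le> infdist (t *\<^sub>R z - (- a)) Y"
    using Y t by (intro infdist_subspace_scale_ge subspace_neg)
  finally show ?thesis
    using r t by (intro that[of "a + t *\<^sub>R z"]) (auto simp: add.commute subset_iff dist_norm)
qed

text \<open>
  Close to \<open>x\<close> there are only tiles through \<open>x\<close>, and each of them other than \<open>C\<close> lies in the half-space
  where \<open>f D\<close> is at least \<open>f D x\<close>. A small step that decreases all these functionals
  avoids them and, as the tiles cover the space, must end in \<open>C\<close>.
\<close>

lemma tile_stays_in_direction:
  fixes \<T> :: "'a::real_normed_vector set set" and f :: "'a set \<Rightarrow> 'a \<Rightarrow> real"
  assumes lf: "locally_finite_in euclidean \<T>" and cover: "\<Union>\<T> = UNIV"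
    and closed: "\<And>D. D \<in> \<T> \<Longrightarrow> closed D"
    and lin: "\<And>D. D \<in> \<T> - {C} \<Longrightarrow> linear (f D)"
    and sep: "\<And>D d. D \<in> \<T> - {C} \<Longrightarrow> d \<in> D \<Longrightarrow> f D x \<le> f D d"
    and v: "\<And>D. D \<in> \<T> - {C} \<Longrightarrow> x \<in> D \<Longrightarrow> f D v < 0"
  obtains t where "0 < t" "x + t *\<^sub>R v \<in> C"
proof -
  obtain W where W: "open W" "x \<in> W" "W \<subseteq> \<Union>{D \<in> \<T>. x \<in> D}"
    using locally_finite_cover_neighbourhood[OF lf cover closed] by metis
  obtain e where e: "0 < e" "ball x e \<subseteq> W"
    using W by (meson open_contains_ball)
  define t where "t = e / (norm v + 1)"
  have t: "0 < t" "norm (t *\<^sub>R v) < e"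
    using e by (auto simp: t_def field_simps add_pos_nonneg)
  then have "x + t *\<^sub>R v \<in> W"
    using e by (auto simp: subset_iff dist_norm)
  then obtain D where D: "D \<in> \<T>" "x \<in> D" "x + t *\<^sub>R v \<in> D"
    using W by blast
  have "D = C"
  proof (rule ccontr)
    assume "D \<noteq> C"
    with D have DC: "D \<in> \<T> - {C}" by simp
    have "f D (x + t *\<^sub>R v) = f D x + t * f D v"
      using lin[OF DC] by (simp add: linear_add linear_scale)
    also have "\<dots> < f D x"
      using v[OF DC D(2)] t by (simp add: mult_pos_neg)
    finally show False
      using sep[OF DC D(3)] by simp
  qed
  with D t that show ?thesis by blast
qed

text \<open>
  Let \<open>x\<close> be an Ekeland point of \<open>C\<close> for the distance to \<open>Y\<close>, at distance \<open>d > 0\<close>, and let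
  \<open>y0 \<in> Y\<close> be nearly closest to \<open>x\<close>. By hypothesis some \<open>y1 \<in> Y\<close>, of norm comparable to
  \<open>d\<close>, has almost the same values as \<open>x - y0\<close> under the functionals of the tiles through \<open>x\<close>. So
  these functionals almost vanish on \<open>x - y0 - y1\<close>, and a small multiple of
  \<open>a - x\<close>, on which they are strictly negative, tips the balance. The resulting direction
  \<open>v\<close> is congruent to \<open>(1 - s) *\<^sub>R x\<close> modulo \<open>Y\<close>, hence the distance to \<open>Y\<close> grows at rate
  \<open>(1 - s) * d\<close> along it.
\<close>

lemma approximating_subspace_dense:
  fixes \<T> :: "'a::banach set set" and f :: "'a set \<Rightarrow> 'a \<Rightarrow> real"
  assumes lf: "locally_finite_in euclidean \<T>" and cover: "\<Union>\<T> = UNIV"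
    and closed: "\<And>D. D \<in> \<T> \<Longrightarrow> closed D"
    and C: "C \<in> \<T>" "bounded C"
    and lin: "\<And>D. D \<in> \<T> - {C} \<Longrightarrow> linear (f D)"
    and sep: "\<And>D c d. D \<in> \<T> - {C} \<Longrightarrow> c \<in> C \<Longrightarrow> d \<in> D \<Longrightarrow> f D c \<le> f D d"
    and sep_strict: "\<And>D d. D \<in> \<T> - {C} \<Longrightarrow> d \<in> D \<Longrightarrow> f D a < f D d"
    and Y: "subspace Y" and a: "a \<in> interior C" "a \<in> Y"
    and approx: "\<And>F x \<eta>. finite F \<Longrightarrow> F \<subseteq> \<T> - {C} \<Longrightarrow> 0 < \<eta> \<Longrightarrow>
       \<exists>y\<in>Y. norm y < norm x + \<eta> \<and> (\<forall>D\<in>F. \<bar>f D y - f D x\<bar> < \<eta>)"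
  shows "closure Y = UNIV"
proof (rule ccontr)
  assume "closure Y \<noteq> UNIV"
  then obtain z where z: "z \<notin> closure Y" by blast
  obtain b where b: "b \<in> C" "0 < infdist b Y"
    using interior_point_off_subspace[OF Y a(2,1) z] .
  have "bdd_above ((\<lambda>x. infdist x Y) ` C)"
  proof -
    obtain M where "\<And>x. x \<in> C \<Longrightarrow> dist a x \<le> M"
      using C(2) bounded_any_center by metis
    then have "infdist x Y \<le> M" if "x \<in> C" for x
      using infdist_le[OF a(2), of x] that by (metis dist_commute order_trans)
    then show ?thesis by (auto simp: bdd_above_def)
  qed
  moreover have "continuous_on C (\<lambda>x. infdist x Y)"
    by (intro continuous_intros)
  \<comment> \<open>The slope \<open>1/12\<close> is the ratio of the two estimates below: along \<open>v\<close> the distance grows at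
    rate at least \<open>d / 2\<close>, while \<open>norm v\<close> is at most \<open>6 * d\<close>.\<close>
  moreover have "(0::real) < 1/12" by simp
  ultimately obtain x where x: "x \<in> C" "infdist b Y \<le> infdist x Y"
    and max: "\<And>y. y \<in> C \<Longrightarrow> infdist x Y + 1/12 * dist x y \<le> infdist y Y \<Longrightarrow> y = x"
    using ekeland_maximum[OF closed[OF C(1)] b(1)] by metis
  define d where "d = infdist x Y"
  have d: "0 < d"
    using b x by (simp add: d_def)
  obtain y0 where y0: "y0 \<in> Y" "norm (x - y0) < 2 * d"
  proof -
    have "(INF y\<in>Y. dist x y) < 2 * d"
    proof -
      have "Y \<noteq> {}" using a by blast
      from infdist_notempty[OF this, of x] show ?thesis
        using d by (simp add: d_def)
    qed
    then obtain y where "y \<in> Y" "dist x y < 2 * d"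
      using cInf_lessD[of "dist x ` Y"] a by auto
    then show ?thesis
      using that by (simp add: dist_norm)
  qed
  define F where "F = {D \<in> \<T>. x \<in> D} - {C}"
  have F: "finite F" "F \<subseteq> \<T> - {C}"
    using locally_finite_cover_neighbourhood[OF lf cover closed, of x]
    by (auto simp: F_def)
  \<comment> \<open>The weight of the correction \<open>a - x\<close>: it must not cost more than half of the growth, nor
    contribute more than \<open>d\<close> to \<open>norm v\<close>.\<close>
  define s where "s = min (1/2) (d / (norm (x - a) + 1))"
  have s: "0 < s" "s \<le> 1/2" "s * norm (x - a) \<le> d"
  proof -
    show "0 < s"
      using d by (simp add: s_def add_nonneg_pos)
    show "s \<le> 1/2"
      unfolding s_def by (rule min.cobounded1)
    have "s * norm (x - a) \<le> d / (norm (x - a) + 1) * (norm (x - a) + 1)"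
      using d by (intro mult_mono) (auto simp: s_def)
    also have "\<dots> = d"
      by (smt (verit) nonzero_eq_divide_eq norm_ge_zero)
    finally show "s * norm (x - a) \<le> d" .
  qed
  \<comment> \<open>An error that the gain \<open>s * (f D x - f D a)\<close> of the correction outweighs for every tile
    through \<open>x\<close>.\<close>
  define \<eta> where "\<eta> = Min (insert d ((\<lambda>D. s * (f D x - f D a)) ` F))"
  have \<eta>: "\<eta> \<le> d" "\<And>D. D \<in> F \<Longrightarrow> \<eta> \<le> s * (f D x - f D a)"
    unfolding \<eta>_def using F by (auto intro!: Min_le)
  have "0 < s * (f D x - f D a)" if "D \<in> F" for D
    using that s sep_strict[of D x] by (simp add: F_def)
  then have \<eta>0: "0 < \<eta>"
    using F d by (auto simp: \<eta>_def)
  obtain y1 where y1: "y1 \<in> Y" "norm y1 < norm (x - y0) + \<eta>"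
      "\<And>D. D \<in> F \<Longrightarrow> \<bar>f D y1 - f D (x - y0)\<bar> < \<eta>"
    using approx[OF F \<eta>0] by blast
  define y where "y = y0 + y1 - s *\<^sub>R a"
  have y: "y \<in> Y"
    unfolding y_def using Y y0 y1 a by (intro subspace_add subspace_diff subspace_scale)
  define v where "v = (1 - s) *\<^sub>R x - y"
  have v_eq: "v = (x - y0 - y1) - s *\<^sub>R (x - a)"
    by (simp add: v_def y_def algebra_simps)
  have "norm v \<le> norm (x - y0) + norm y1 + s * norm (x - a)"
    using norm_triangle_ineq4[of "x - y0 - y1" "s *\<^sub>R (x - a)"]
      norm_triangle_ineq4[of "x - y0" y1] s by (simp add: v_eq)
  then have v: "norm v \<le> 6 * d"
    using y0 y1 \<eta>(1) s by linarith
  have fv: "f D v < 0" if "D \<in> \<T> - {C}" "x \<in> D" for D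
  proof -
    have D: "D \<in> F"
      using that by (simp add: F_def)
    have "f D v = (f D (x - y0) - f D y1) - s * (f D x - f D a)"
      using lin[OF that(1)] by (simp add: v_eq linear_diff linear_scale)
    then show ?thesis
      using y1(3)[OF D] \<eta>(2)[OF D] by linarith
  qed
  obtain t where t: "0 < t" "x + t *\<^sub>R v \<in> C"
    using tile_stays_in_direction[OF lf cover closed lin sep[OF _ x(1)] fv] .
  have "(1 + t * (1 - s)) * d \<le> infdist ((1 + t * (1 - s)) *\<^sub>R x - t *\<^sub>R y) Y"
    unfolding d_def using Y y t s
    by (intro infdist_subspace_scale_ge subspace_scale) (auto intro: add_pos_nonneg)
  also have "(1 + t * (1 - s)) *\<^sub>R x - t *\<^sub>R y = x + t *\<^sub>R v"
    by (simp add: v_def algebra_simps)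
  finally have grow: "d + t * (1 - s) * d \<le> infdist (x + t *\<^sub>R v) Y"
    by (simp add: algebra_simps)
  have "1/12 * dist x (x + t *\<^sub>R v) = t * (norm v / 12)"
    using t by (simp add: dist_norm)
  also have "\<dots> \<le> t * ((1 - s) * d)"
  proof (intro mult_left_mono)
    have "1/2 * d \<le> (1 - s) * d"
      using s d by (intro mult_right_mono) auto
    with v show "norm v / 12 \<le> (1 - s) * d"
      by linarith
  qed (use t in simp)
  finally have "d + 1/12 * dist x (x + t *\<^sub>R v) \<le> d + t * (1 - s) * d"
    by (simp add: mult.assoc)
  with grow have "x + t *\<^sub>R v = x"
    using t(2) by (intro max) (simp_all add: d_def)
  then have "d + t * (1 - s) * d \<le> d"
    using grow by (simp only: d_def)
  moreover have "0 < t * (1 - s) * d"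
    using t s d by simp
  ultimately show False by simp
qed

section \<open>The cardinality of a tiling\<close>

lemma tiling_ordLeq_dense:
  fixes \<T> :: "'a::real_normed_vector set set" and D :: "'a set"
  assumes \<T>: "tiling \<T>" and D: "UNIV \<subseteq> closure D"
  shows "|\<T>| \<le>o |D|"
proof -
  have "\<exists>x\<in>D. x \<in> interior C" if "C \<in> \<T>" for C
  proof -
    have "interior C \<noteq> {}"
      using \<T> that by (auto simp: tiling_def convex_body_def)
    then show ?thesis
      using D open_Int_closure_eq_empty[of "interior C" D] by auto
  qed
  then obtain g where g: "\<And>C. C \<in> \<T> \<Longrightarrow> g C \<in> D \<and> g C \<in> interior C"
    by metis
  have "inj_on g \<T>"
    using \<T> g unfolding tiling_def pairwise_def inj_on_def by (metis disjoint_iff)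
  with g show ?thesis
    using card_of_ordLeq by blast
qed

text \<open>
  The norm is put among the functions to be approximated, so that the approximating points are not
  much longer than the points that they imitate.
\<close>

lemma infinite_tiling_dense_subset:
  fixes \<T> :: "'a::banach set set"
  assumes \<T>: "tiling \<T>" and lf: "locally_finite_in euclidean \<T>"
    and C: "C \<in> \<T>" "bounded C" and inf: "infinite \<T>"
  obtains Q :: "'a set" where "|Q| \<le>o |\<T>|" "closure Q = UNIV"
proof -
  have body: "closed D" "convex D" "interior D \<noteq> {}" if "D \<in> \<T>" for D
    using \<T> that by (auto simp: tiling_def convex_body_def)
  have cover: "\<Union>\<T> = UNIV"
    using \<T> by (simp add: tiling_def)
  have "\<exists>f::'a \<Rightarrow> real. bounded_linear f \<and> (\<forall>c\<in>C. \<forall>d\<in>D. f c \<le> f d) \<and>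
      (\<forall>c\<in>interior C. \<forall>d\<in>D. f c < f d)" if "D \<in> \<T> - {C}" for D
  proof (rule separating_functional)
    have "C \<noteq> D" "D \<in> \<T>"
      using that by auto
    then show "interior C \<inter> interior D = {}"
      using \<T> C unfolding tiling_def pairwise_def by blast
  qed (use that C body in auto)
  then obtain f :: "'a set \<Rightarrow> 'a \<Rightarrow> real" where
    lin: "\<And>D. D \<in> \<T> - {C} \<Longrightarrow> linear (f D)" and
    sep: "\<And>D c d. D \<in> \<T> - {C} \<Longrightarrow> c \<in> C \<Longrightarrow> d \<in> D \<Longrightarrow> f D c \<le> f D d" and
    sep_strict: "\<And>D c d. D \<in> \<T> - {C} \<Longrightarrow> c \<in> interior C \<Longrightarrow> d \<in> D \<Longrightarrow> f D c < f D d"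
    by (metis bounded_linear.linear)
  obtain a where a: "a \<in> interior C"
    using body C by blast
  have "|insert norm (f ` \<T>)| \<le>o |\<T>|"
    by (intro card_of_insert_ordLeq_infinite inf card_of_image)
  then obtain S :: "'a set" where S: "|S| \<le>o |\<T>|"
    and S_approx: "\<And>F x \<eta>. finite F \<Longrightarrow> F \<subseteq> insert norm (f ` \<T>) \<Longrightarrow> 0 < \<eta> \<Longrightarrow>
        \<exists>s\<in>S. \<forall>g\<in>F. \<bar>g s - g x\<bar> < \<eta>"
    using small_simultaneous_approximation[OF inf] by metis
  obtain Q where Q: "|Q| \<le>o |\<T>|" "span (insert a S) \<subseteq> closure Q"
    using small_dense_subset_of_span[OF inf card_of_insert_ordLeq_infinite[OF inf S]] .
  have "\<exists>y\<in>span (insert a S). norm y < norm x + \<eta> \<and> (\<forall>D\<in>F. \<bar>f D y - f D x\<bar> < \<eta>)"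
    if F: "finite F" "F \<subseteq> \<T> - {C}" and \<eta>: "0 < \<eta>" for F x \<eta>
  proof -
    obtain y where y: "y \<in> S" "\<forall>g\<in>insert norm (f ` F). \<bar>g y - g x\<bar> < \<eta>"
      using S_approx[of "insert norm (f ` F)" \<eta> x] F \<eta> by blast
    then have "norm y < norm x + \<eta> \<and> (\<forall>D\<in>F. \<bar>f D y - f D x\<bar> < \<eta>)"
      by (auto simp: abs_less_iff)
    then show ?thesis
      using y(1) by (intro bexI[of _ y] span_base) auto
  qed
  then have "closure (span (insert a S)) = UNIV"
    by (intro approximating_subspace_dense[OF lf cover body(1) C lin sep sep_strict[OF _ a] _ a])
      (auto intro: span_base)
  then have "closure Q = UNIV"
    using closure_minimal[OF Q(2) closed_closure] by auto
  with Q(1) that show ?thesis by blast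
qed

theorem fact4p12:
  fixes \<T> :: "'a::banach set set"
  assumes "tiling \<T>"
    and "locally_finite_in euclidean \<T>"
    and "\<And>C. C \<in> \<T> \<Longrightarrow> bounded C"
  shows "|\<T>| =o dens (UNIV :: 'a set)"
proof -
  obtain D :: "'a set" where D: "UNIV \<subseteq> closure D" "dens (UNIV :: 'a set) = |D|"
    and least: "\<And>E :: 'a set. UNIV \<subseteq> closure E \<Longrightarrow> |D| \<le>o |E|"
    using dens_attained[of "UNIV :: 'a set"] by (metis subset_UNIV)
  have ne: "\<T> \<noteq> {}"
    using assms(1) by (auto simp: tiling_def)
  have "|D| \<le>o |\<T>|"
  proof (cases "finite \<T>")
    \<comment> \<open>Finitely many bounded tiles cover only the trivial space.\<close>
    case True
    then have "bounded (UNIV :: 'a set)"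
      using assms(1,3) bounded_Union[of \<T>] by (simp add: tiling_def)
    then obtain M where M: "\<And>x :: 'a. norm x \<le> M"
      by (auto simp: bounded_iff)
    have "x = 0" for x :: 'a
    proof (rule ccontr)
      assume "x \<noteq> 0"
      then show False
        using M[of "((\<bar>M\<bar> + 1) / norm x) *\<^sub>R x"] by simp
    qed
    then have "closure {0 :: 'a} = UNIV"
      by auto
    then have "|D| \<le>o |{0 :: 'a}|"
      by (intro least) simp
    also have "|{0 :: 'a}| \<le>o |\<T>|"
      using ne by (simp add: card_of_singl_ordLeq)
    finally show ?thesis .
  next
    case False
    then obtain Q :: "'a set" where "|Q| \<le>o |\<T>|" "closure Q = UNIV"
      using infinite_tiling_dense_subset[OF assms(1,2)] assms(3) ne by (metis ex_in_conv)
    then show ?thesis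
      using least[of Q] ordLeq_transitive by blast
  qed
  moreover have "|\<T>| \<le>o |D|"
    using tiling_ordLeq_dense[OF assms(1) D(1)] .
  ultimately show ?thesis
    by (simp add: D(2) ordIso_iff_ordLeq)
qed

end
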